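(* Let $(\alpha,m)\in[0,1]\times(0,1]$ and $b>a>0$ with $a<mb$. Let $n\ge 2$ be an integer and let $p\ge 1$ be real. Suppose $f:[0,b]\to\mathbb{R}$ is $n$-times differentiable on $[0,b]$, $|f^{(n)}|\in L([0,mb])$, and $|f^{(n)}|^p$ is $(\alpha,m)$-convex on $[0,mb]$. Then $$\left|\frac{f(a)+f(mb)}{2}-\frac{1}{mb-a}\int_{a}^{mb}f(x)\,dx-\frac12\sum_{k=2}^{n-1}\frac{(k-1)(mb-a)^k}{(k+1)!}f^{(k)}(a)\right|$$ $$\le\frac{(n-1)^{1-1/p}}{2}\frac{(mb-a)^n}{n!}\left\{\frac{(n-2)(pn-p+\alpha)+2(n-1)}{(pn-p+\alpha+1)(pn-p+\alpha+2)}|f^{(n)}(a)|^p+m\left[\frac{(n-1)(pn-2p+2)}{(pn-p+1)(pn-p+2)}-\frac{(n-2)(pn-p+\alpha)+2(n-1)}{(pn-p+\alpha+1)(pn-p+\alpha+2)}\right]|f^{(n)}(b)|^p\right\}^{1/p},$$ where the sum is $0$ when $n=2$.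
   Context: For $c>0$ and $(\alpha,m)\in[0,1]\times[0,1]$, a function $g$ is called $(\alpha,m)$-convex on $[0,c]$ if $g(\lambda x+m(1-\lambda)y)\le\lambda^\alpha g(x)+m(1-\lambda^\alpha)g(y)$ for all $x,y\in[0,c]$ and all $\lambda\in(0,1]$. $L([0,c])$ denotes the space of Lebesgue integrable functions on $[0,c]$. Derivatives at endpoints of a closed interval are one-sided.
   Formalization: The (α,m)-convexity of |f^(n)|^p is assumed on [0,b] instead of [0,mb]; with [0,mb] the inequality fails, e.g. f = x^4/3 − x^5/20, n=2, p=α=1, m=1/4, a=1/2, b=4. *)

theory Defs
  imports "HOL-Analysis.Analysis"
begin

text \<open>
  Derivatives are taken within \<open>S\<close>, so they are one-sided at the endpoints of a closed interval,
  and values of \<open>f\<close> outside \<open>S\<close> play no role.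
\<close>

definition nth_deriv_on :: "real set \<Rightarrow> nat \<Rightarrow> (real \<Rightarrow> real) \<Rightarrow> real \<Rightarrow> real" where
  "nth_deriv_on S n f = ((\<lambda>g x. vector_derivative g (at x within S)) ^^ n) f"

definition n_times_differentiable_on :: "nat \<Rightarrow> (real \<Rightarrow> real) \<Rightarrow> real set \<Rightarrow> bool" where
  "n_times_differentiable_on n f S \<longleftrightarrow> (\<forall>k<n. nth_deriv_on S k f differentiable_on S)"

text \<open>
  The parameter \<open>l\<close> is never 0, so \<open>l powr 0 = 1\<close> is the usual convention for \<open>\<alpha> = 0\<close>.

  The inequality of the theorem bounds by the value of \<open>g = \<bar>f\<^sup>(\<^sup>n\<^sup>)\<bar>\<^sup>p\<close> at \<open>b\<close>, which lies outside
  \<open>[0, m b]\<close> for \<open>m < 1\<close>. Convexity with \<open>x\<close>, \<open>y\<close> ranging over \<open>[0, m b]\<close>, as in the source, does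
  not constrain \<open>g b\<close>, and the inequality then fails: take \<open>f x = x^4/3 - x^5/20\<close>, \<open>n = 2\<close>,
  \<open>p = \<alpha> = 1\<close>, \<open>m = 1/4\<close>, \<open>a = 1/2\<close>, \<open>b = 4\<close>, so \<open>g b = 0\<close>. The theorem therefore takes \<open>c = b\<close>,
  which for \<open>m = 1\<close> is the same hypothesis.
\<close>

definition alpha_m_convex :: "real \<Rightarrow> real \<Rightarrow> real \<Rightarrow> (real \<Rightarrow> real) \<Rightarrow> bool" where
  "alpha_m_convex \<alpha> m c g \<longleftrightarrow>
     (\<forall>x\<in>{0..c}. \<forall>y\<in>{0..c}. \<forall>l\<in>{0<..1}.
        g (l * x + m * (1 - l) * y) \<le> l powr \<alpha> * g x + m * (1 - l powr \<alpha>) * g y)"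

end

theory Submission
  imports Defs
begin

text \<open>
  Put \<open>c = m b\<close>, \<open>d = c - a\<close> and let \<open>F\<close> be an antiderivative of \<open>f\<close>. The corrected
  trapezoid defect is a difference of two Taylor remainders: \<open>1/2\<close> times the remainder of
  order \<open>n\<close> of \<open>f\<close> at \<open>c\<close>, minus \<open>1/d\<close> times the remainder of order \<open>n + 1\<close> of \<open>F\<close> at \<open>c\<close>. Both are
  integrals against \<open>f\<^sup>(\<^sup>n\<^sup>)\<close>, and the two Taylor polynomials at \<open>a\<close> combine to the correction sum,
  because \<open>1/(2 k!) - 1/(k+1)! = (k-1)/(2 (k+1)!)\<close>: this is \<open>-1/2\<close> for \<open>k = 0\<close>, which puts \<open>f a / 2\<close>
  on the left, and \<open>0\<close> for \<open>k = 1\<close>, which is why the sum starts at \<open>k = 2\<close>. In the variable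
  \<open>t = (c - x) / d\<close> the outcome is
  \<open>d^n / (2 n!) * (\<integral> t^(n-1) (n - 2 t) f\<^sup>(\<^sup>n\<^sup>)(c - d t) dt)\<close> over \<open>[0, 1]\<close>
  (lemma \<open>corrected_trapezoid_has_integral\<close>).

  Since \<open>n \<ge> 2\<close>, the weight \<open>n - 2 t\<close> is nonnegative on \<open>[0, 1]\<close>; its mass is \<open>n - 1\<close>. The power mean
  inequality for this weight (lemma \<open>weighted_power_mean_integral\<close>) gives the factor
  \<open>(n - 1) powr (1 - 1/p)\<close> and reduces the claim to a bound for
  \<open>t^(p (n-1)) \<bar>f\<^sup>(\<^sup>n\<^sup>)(c - d t)\<bar>^p\<close>. As \<open>c - d t = t a + m (1 - t) b\<close>, convexity gives the
  majorant \<open>t^(p (n-1)) (t^\<alpha> A + m (1 - t^\<alpha>) B)\<close> with \<open>A\<close>, \<open>B\<close> the values of \<open>\<bar>f\<^sup>(\<^sup>n\<^sup>)\<bar>^p\<close> at \<open>a\<close>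
  and \<open>b\<close>. Its weighted integral is a combination of two moments of \<open>n - 2 t\<close>
  (lemma \<open>linear_weight_moment\<close>), and these are the two rational expressions of the theorem.

  The power mean inequality is proved with tangent lines of the concave function \<open>v^(1/p)\<close>,
  that is, through pointwise majorants that are affine in the majorant \<open>v\<close> of the \<open>p\<close>-th power. So all
  integrals on the right are integrals of explicit powers, while the integral on the left
  comes from the fundamental theorem of calculus for the gauge integral.
\<close>

section \<open>The trapezoid defect as an integral against the highest derivative\<close>

lemma nth_deriv_on_0: "nth_deriv_on S 0 f = f"
  by (simp add: nth_deriv_on_def)

lemma nth_deriv_on_has_vector_derivative:
  assumes "n_times_differentiable_on n f S" "k < n" "x \<in> S"
  shows "(nth_deriv_on S k f has_vector_derivative nth_deriv_on S (Suc k) f x) (at x within S)"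
proof -
  have "nth_deriv_on S k f differentiable (at x within S)"
    using assms by (auto simp: n_times_differentiable_on_def differentiable_on_def)
  then show ?thesis
    by (simp add: vector_derivative_works nth_deriv_on_def)
qed

lemma trapezoid_coefficient:
  "1 / (2 * fact k) - 1 / fact (Suc k) = (real k - 1) / (2 * fact (k + 1))"
proof -
  have "1 / (2 * x) - 1 / (y * x) = (y - 2) / (2 * (y * x))" if "x \<noteq> 0" "y \<noteq> 0" for x y :: real
    using that by (simp add: field_simps)
  from this[of "fact k" "1 + real k"] show ?thesis
    by simp
qed

text \<open>
  The sequence \<open>D\<close> lists \<open>f\<close> and its derivatives. Taylor's formula is used for the sequence \<open>D\<close> and
  for the same sequence with an antiderivative of \<open>f\<close> put in front.
\<close>

lemma corrected_trapezoid_has_integral: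
  fixes D :: "nat \<Rightarrow> real \<Rightarrow> real" and a c :: real
  assumes "a < c" and n: "2 \<le> n"
    and D: "\<And>k x. k < n \<Longrightarrow> a \<le> x \<Longrightarrow> x \<le> c \<Longrightarrow>
              (D k has_vector_derivative D (Suc k) x) (at x within {a..c})"
  shows "((\<lambda>x. ((c - x) ^ (n - 1) / (2 * fact (n - 1)) - (c - x) ^ n / ((c - a) * fact n)) * D n x)
           has_integral
             ((D 0 a + D 0 c) / 2 - 1 / (c - a) * integral {a..c} (D 0)
              - 1 / 2 * (\<Sum>k=2..n-1. (real k - 1) * (c - a) ^ k / fact (k + 1) * D k a))) {a..c}"
    (is "(?J has_integral ?T) _")
proof -
  define d where "d = c - a"
  have d: "d > 0" using assms by (simp add: d_def)
  define F where "F = (\<lambda>u. integral {a..u} (D 0))"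
  define E where "E = case_nat F D"
  have cont: "continuous_on {a..c} (D 0)"
    unfolding continuous_on_eq_continuous_within
    using D n by (force intro: has_vector_derivative_continuous)
  have F: "(F has_vector_derivative D 0 x) (at x within {a..c})" if "a \<le> x" "x \<le> c" for x
    unfolding F_def using integral_has_vector_derivative[OF cont] that by simp
  have E: "(E k has_vector_derivative E (Suc k) x) (at x within {a..c})"
    if "k < Suc n" "a \<le> x" "x \<le> c" for k x
    using that D F by (cases k) (auto simp: E_def)
  have t1: "((\<lambda>x. ((c - x) ^ (n - 1) / fact (n - 1)) *\<^sub>R D n x) has_integral
              D 0 c - (\<Sum>i<n. (d ^ i / fact i) *\<^sub>R D i a)) {a..c}"
    unfolding d_def using assms by (intro Taylor_has_integral) auto
  have t2: "((\<lambda>x. ((c - x) ^ (Suc n - 1) / fact (Suc n - 1)) *\<^sub>R E (Suc n) x) has_integral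
              F c - (\<Sum>i<Suc n. (d ^ i / fact i) *\<^sub>R E i a)) {a..c}"
    unfolding d_def using assms E by (intro Taylor_has_integral) (auto simp: E_def)
  have Fa: "F a = 0" by (simp add: F_def)
  have t2': "((\<lambda>x. ((c - x) ^ n / fact n) * D n x) has_integral
              F c - (\<Sum>i<n. (d ^ Suc i / fact (Suc i)) * D i a)) {a..c}"
    using t2 by (subst (asm) sum.lessThan_Suc_shift) (simp add: E_def Fa del: fact_Suc power_Suc)
  let ?V = "1 / 2 * (D 0 c - (\<Sum>i<n. d ^ i / fact i * D i a))
              - 1 / d * (F c - (\<Sum>i<n. d ^ Suc i / fact (Suc i) * D i a))"
  have "((\<lambda>x. 1 / 2 * ((c - x) ^ (n - 1) / fact (n - 1) * D n x)
             - 1 / d * ((c - x) ^ n / fact n * D n x)) has_integral ?V) {a..c}"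
    using has_integral_diff[OF has_integral_mult_right[OF t1, of "1 / 2"]
        has_integral_mult_right[OF t2', of "1 / d"]]
    by simp
  also have "(\<lambda>x. 1 / 2 * ((c - x) ^ (n - 1) / fact (n - 1) * D n x)
             - 1 / d * ((c - x) ^ n / fact n * D n x)) = ?J"
    by (auto simp: d_def algebra_simps)
  also have "?V = ?T"
  proof -
    let ?s = "\<lambda>k. (real k - 1) / (2 * fact (k + 1)) * d ^ k * D k a"
    have "?V = 1 / 2 * D 0 c - 1 / d * F c
                - (1 / 2 * (\<Sum>i<n. d ^ i / fact i * D i a)
                   - 1 / d * (\<Sum>i<n. d ^ Suc i / fact (Suc i) * D i a))"
      unfolding right_diff_distrib by linarith
    also have "1 / 2 * (\<Sum>i<n. d ^ i / fact i * D i a)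
            - 1 / d * (\<Sum>i<n. d ^ Suc i / fact (Suc i) * D i a) = (\<Sum>k<n. ?s k)"
      unfolding sum_distrib_left sum_subtractf[symmetric]
    proof (rule sum.cong)
      fix k assume "k \<in> {..<n}"
      have "1 / 2 * (d ^ k / fact k * D k a) - 1 / d * (d ^ Suc k / fact (Suc k) * D k a)
              = (1 / (2 * fact k) - 1 / fact (Suc k)) * d ^ k * D k a"
        using d by (simp add: left_diff_distrib del: fact_Suc)
      then show "1 / 2 * (d ^ k / fact k * D k a) - 1 / d * (d ^ Suc k / fact (Suc k) * D k a) = ?s k"
        by (simp only: trapezoid_coefficient)
    qed simp
    also have "(\<Sum>k<n. ?s k) = - D 0 a / 2 + (\<Sum>k=2..n-1. ?s k)"
    proof -
      have "{..<n} = insert 0 (insert 1 {2..n-1})"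
        using n by auto
      then show ?thesis by simp
    qed
    also have "(\<Sum>k=2..n-1. ?s k)
                = 1 / 2 * (\<Sum>k=2..n-1. (real k - 1) * (c - a) ^ k / fact (k + 1) * D k a)"
      unfolding sum_distrib_left d_def by (rule sum.cong) (auto simp del: fact_Suc)
    finally show ?thesis
      by (simp add: F_def d_def add_divide_distrib)
  qed
  finally show ?thesis .
qed

lemma has_integral_to_unit_interval_reversed:
  fixes J :: "real \<Rightarrow> real"
  assumes "(J has_integral I) {a..c}" "a < c"
  shows "((\<lambda>t. (c - a) * J (c - (c - a) * t)) has_integral I) {0..1}"
proof -
  have "((\<lambda>x. J (- x)) has_integral I) (cbox (- c) (- a))"
    using assms by simp
  from has_integral_affinity'[OF this, of "c - a" "- c"] assms
  have "((\<lambda>t. J (c - (c - a) * t)) has_integral I / (c - a)) {0..1}"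
    by (simp add: divide_inverse_commute)
  from has_integral_mult_right[OF this, of "c - a"] assms show ?thesis
    by simp
qed

section \<open>The weighted power mean inequality\<close>

text \<open>
  For \<open>v = u powr p\<close> the right side is the tangent line of \<open>v powr (1 / p)\<close> at \<open>v = s\<close>, whose graph
  lies above that of the concave function.
\<close>

lemma le_tangent_of_root:
  fixes u v s p :: real
  assumes "1 \<le> p" "0 < s" "0 \<le> u" "u powr p \<le> v"
  shows "u \<le> s powr (1 / p - 1) / p * v + (1 - 1 / p) * s powr (1 / p)"
proof (cases "u = 0")
  case True
  with assms show ?thesis
    by (intro order_trans[OF _ add_nonneg_nonneg] mult_nonneg_nonneg divide_nonneg_nonneg) auto
next
  case False
  then have u: "u > 0" using assms by simp
  have "(u powr p) powr (1 / p) * s powr (1 - 1 / p) \<le> 1 / p * u powr p + (1 - 1 / p) * s"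
    using assms u by (intro Youngs_inequality_0) auto
  then have "u * s powr (1 - 1 / p) \<le> 1 / p * v + (1 - 1 / p) * s"
    using assms u mult_left_mono[OF assms(4), of "1 / p"] by (simp add: powr_powr)
  from mult_right_mono[OF this, of "s powr (1 / p - 1)"]
  have "u * (s powr (1 - 1 / p) * s powr (1 / p - 1))
          \<le> s powr (1 / p - 1) / p * v + (1 - 1 / p) * (s * s powr (1 / p - 1))"
    by (simp add: algebra_simps)
  also have "s powr (1 - 1 / p) * s powr (1 / p - 1) = 1"
    using assms by (simp flip: powr_add)
  also have "s * s powr (1 / p - 1) = s powr (1 / p)"
    using assms by (simp add: powr_mult_base)
  finally show ?thesis by simp
qed

text \<open>
  The majorant \<open>v\<close> of \<open>u powr p\<close> gets a tangent line at a point \<open>s > V / M\<close>; its weighted integral is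
  at most \<open>M * s powr (1 / p)\<close>, and \<open>s\<close> then tends to the mean \<open>V / M\<close>. The limit, instead of the
  choice \<open>s = V / M\<close>, also covers \<open>V = 0\<close>, where there is no tangent line at the mean.
\<close>

lemma weighted_power_mean_integral:
  fixes h u v w :: "real \<Rightarrow> real" and p M V I :: real
  assumes p: "1 \<le> p" and M: "0 < M"
    and w: "(w has_integral M) S" and wv: "((\<lambda>t. w t * v t) has_integral V) S"
    and h: "(h has_integral I) S"
    and w0: "\<And>t. t \<in> S \<Longrightarrow> 0 \<le> w t" and u0: "\<And>t. t \<in> S \<Longrightarrow> 0 \<le> u t"
    and hu: "\<And>t. t \<in> S \<Longrightarrow> \<bar>h t\<bar> \<le> w t * u t"
    and uv: "\<And>t. t \<in> S \<Longrightarrow> u t powr p \<le> v t"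
  shows "\<bar>I\<bar> \<le> M powr (1 - 1 / p) * V powr (1 / p)"
proof -
  have v0: "0 \<le> v t" if "t \<in> S" for t
    using order_trans[OF powr_ge_zero uv[OF that]] .
  have V0: "0 \<le> V"
    using has_integral_nonneg[OF wv] w0 v0 by simp
  have bound: "\<bar>I\<bar> \<le> M * s powr (1 / p)" if s: "V / M < s" for s
  proof -
    have s0: "0 < s" using le_less_trans[OF _ s, of 0] V0 M by simp
    define k where "k = s powr (1 / p - 1) / p"
    define l where "l = (1 - 1 / p) * s powr (1 / p)"
    have k0: "0 \<le> k" using p by (simp add: k_def)
    have g: "((\<lambda>t. k * (w t * v t) + l * w t) has_integral k * V + l * M) S"
      by (intro has_integral_add has_integral_mult_right w wv)
    have le: "norm (h t) \<le> k * (w t * v t) + l * w t" if "t \<in> S" for t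
    proof -
      have "u t \<le> k * v t + l"
        unfolding k_def l_def using le_tangent_of_root[OF p s0 u0 uv] that by blast
      from mult_left_mono[OF this w0[OF that]] hu[OF that] show ?thesis
        by (simp add: algebra_simps)
    qed
    have "\<bar>I\<bar> \<le> k * V + l * M"
      using integral_norm_bound_integral[OF has_integral_integrable[OF h] has_integral_integrable[OF g] le]
        integral_unique[OF h] integral_unique[OF g]
      by simp
    also have "\<dots> \<le> k * (s * M) + l * M"
      using k0 s M by (intro add_right_mono mult_left_mono) (auto simp: field_simps)
    also have "s * s powr (1 / p - 1) = s powr (1 / p)"
      using s0 by (simp add: powr_mult_base)
    then have "k * (s * M) + l * M = M * s powr (1 / p)"
      using p by (simp add: k_def l_def field_simps)
    finally show ?thesis .
  qed
  have "((\<lambda>s. M * s powr (1 / p)) \<longlongrightarrow> M * (V / M) powr (1 / p)) (at_right (V / M))"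
    using p V0 M
    by (intro tendsto_intros disjI2 conjI)
       (auto simp: eventually_at_right_less intro!: eventually_mono[OF eventually_at_right_less]
             intro: less_imp_le order_trans[OF divide_nonneg_pos])
  then have "\<bar>I\<bar> \<le> M * (V / M) powr (1 / p)"
    by (rule tendsto_lowerbound)
       (auto intro!: eventually_mono[OF eventually_at_right_less] bound)
  also have "\<dots> = M powr (1 - 1 / p) * V powr (1 / p)"
    using M V0 by (simp add: powr_divide powr_diff)
  finally show ?thesis .
qed

lemma linear_weight_moment:
  fixes n q :: real
  assumes "0 \<le> q"
  shows "((\<lambda>t. (n - 2 * t) * t powr q) has_integral
           ((n - 2) * q + 2 * (n - 1)) / ((q + 1) * (q + 2))) {0..1}"
proof -
  have "((\<lambda>t. n * t powr q - 2 * t powr (q + 1)) has_integral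
          n * (1 powr (q + 1) / (q + 1)) - 2 * (1 powr (q + 1 + 1) / (q + 1 + 1))) {0..1}"
    using assms by (intro has_integral_diff has_integral_mult_right has_integral_powr_from_0) auto
  then have "((\<lambda>t. n * t powr q - 2 * t powr (q + 1)) has_integral
          ((n - 2) * q + 2 * (n - 1)) / ((q + 1) * (q + 2))) {0..1}"
    using assms by (auto simp: divide_simps algebra_simps elim!: has_integral_eq_rhs)
  moreover have "n * t powr q - 2 * t powr (q + 1) = (n - 2 * t) * t powr q" if "t \<in> {0..1}" for t
    using that by (simp add: powr_add algebra_simps)
  ultimately show ?thesis
    by (rule has_integral_eq[rotated])
qed

section \<open>The bound for the trapezoid defect\<close>

text \<open>
  The two kernels of Taylor's formula combine, with \<open>t = (c - x) / d\<close>, to a multiple of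
  \<open>t^(n-1) (n - 2 t)\<close>; the factor \<open>d\<close> in front is the Jacobian of this substitution.
\<close>

lemma trapezoid_kernel:
  fixes d t :: real
  assumes "0 < d" "0 < n"
  shows "d * ((d * t) ^ (n - 1) / (2 * fact (n - 1)) - (d * t) ^ n / (d * fact n))
           = d ^ n / (2 * fact n) * ((real n - 2 * t) * t ^ (n - 1))"
proof -
  obtain k where n: "n = Suc k" using assms by (cases n) auto
  have "d * (y ^ k / (2 * x) - d * t * y ^ k / (d * (z * x)))
          = d * y ^ k * (z - 2 * t) / (2 * (z * x))" if "x \<noteq> 0" "z \<noteq> 0" for x y z :: real
    using that assms by (simp add: field_simps)
  from this[of "fact k" "1 + real k" "d * t"] show ?thesis
    by (simp add: n power_mult_distrib mult_ac)
qed

theorem theorem3p3: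
  fixes f :: "real \<Rightarrow> real" and \<alpha> m a b p :: real and n :: nat
  assumes "0 \<le> \<alpha>" and "\<alpha> \<le> 1"
    and "0 < m" and "m \<le> 1"
    and "0 < a" and "a < b" and "a < m * b"
    and "2 \<le> n" and "1 \<le> p"
    and "n_times_differentiable_on n f {0..b}"
    and "(\<lambda>x. \<bar>nth_deriv_on {0..b} n f x\<bar>) absolutely_integrable_on {0..m * b}"
    and "alpha_m_convex \<alpha> m b (\<lambda>x. \<bar>nth_deriv_on {0..b} n f x\<bar> powr p)"
  shows "\<bar>(f a + f (m * b)) / 2 - 1 / (m * b - a) * integral {a..m * b} f
            - 1 / 2 * (\<Sum>k=2..n-1. (real k - 1) * (m * b - a) ^ k / fact (k + 1)
                                     * nth_deriv_on {0..b} k f a)\<bar>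
         \<le> (real n - 1) powr (1 - 1 / p) / 2 * ((m * b - a) ^ n / fact n)
            * (((real n - 2) * (p * n - p + \<alpha>) + 2 * (real n - 1))
                 / ((p * n - p + \<alpha> + 1) * (p * n - p + \<alpha> + 2))
                 * \<bar>nth_deriv_on {0..b} n f a\<bar> powr p
               + m * ((real n - 1) * (p * n - 2 * p + 2) / ((p * n - p + 1) * (p * n - p + 2))
                      - ((real n - 2) * (p * n - p + \<alpha>) + 2 * (real n - 1))
                          / ((p * n - p + \<alpha> + 1) * (p * n - p + \<alpha> + 2)))
                 * \<bar>nth_deriv_on {0..b} n f b\<bar> powr p) powr (1 / p)"
proof -
  define D where "D = (\<lambda>k. nth_deriv_on {0..b} k f)"
  define c where "c = m * b"
  define d where "d = c - a"
  define A where "A = \<bar>D n a\<bar> powr p"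
  define B where "B = \<bar>D n b\<bar> powr p"
  define r where "r = p * n - p"
  define T where "T = (f a + f c) / 2 - 1 / (c - a) * integral {a..c} f
      - 1 / 2 * (\<Sum>k=2..n-1. (real k - 1) * (c - a) ^ k / fact (k + 1) * D k a)"
  define C where "C = d ^ n / (2 * fact n)"
  define Q where "Q = (\<lambda>q. ((real n - 2) * q + 2 * (real n - 1)) / ((q + 1) * (q + 2)))"
  define u where "u = (\<lambda>t. t ^ (n - 1) * \<bar>D n (c - d * t)\<bar>)"
  define v where "v = (\<lambda>t. t powr (r + \<alpha>) * A + m * (t powr r - t powr (r + \<alpha>)) * B)"
  have d: "0 < d" using assms by (simp add: d_def c_def)
  have C: "0 < C" using d by (simp add: C_def)
  have c_le: "c \<le> b" using assms by (simp add: c_def mult_left_le_one_le)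
  have r: "r = p * (real n - 1)" by (simp add: r_def algebra_simps)
  have r0: "0 < r" using assms by (simp add: r)
  have D0: "D 0 = f" by (simp add: D_def nth_deriv_on_0)
  have "(D k has_vector_derivative D (Suc k) x) (at x within {a..c})"
    if "k < n" "a \<le> x" "x \<le> c" for k x
    unfolding D_def using assms c_le that
    by (intro has_vector_derivative_within_subset[OF nth_deriv_on_has_vector_derivative]) auto
  from corrected_trapezoid_has_integral[of a c n D, OF _ _ this]
  have "((\<lambda>x. ((c - x) ^ (n - 1) / (2 * fact (n - 1)) - (c - x) ^ n / (d * fact n)) * D n x)
           has_integral T) {a..c}"
    using assms unfolding T_def d_def D0 c_def by simp
  from has_integral_to_unit_interval_reversed[OF this] d
  have "((\<lambda>t. d * ((d * t) ^ (n - 1) / (2 * fact (n - 1)) - (d * t) ^ n / (d * fact n))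
               * D n (c - d * t)) has_integral T) {0..1}"
    by (simp add: d_def mult.assoc)
  then have "((\<lambda>t. C * ((real n - 2 * t) * t ^ (n - 1)) * D n (c - d * t)) has_integral T) {0..1}"
    using assms d by (subst (asm) trapezoid_kernel) (simp_all add: C_def)
  from has_integral_mult_right[OF this, of "1 / C"] C
  have h: "((\<lambda>t. (real n - 2 * t) * t ^ (n - 1) * D n (c - d * t)) has_integral T / C) {0..1}"
    by (simp add: mult.assoc)
  have w: "((\<lambda>t. real n - 2 * t) has_integral (real n - 1)) {0..1}"
  proof -
    have "((\<lambda>t. real n - 2 * t) has_integral (real n * 1 - 1 ^ 2) - (real n * 0 - 0 ^ 2)) {0..1}"
      by (rule fundamental_theorem_of_calculus)
         (auto intro!: derivative_eq_intros
               simp flip: has_real_derivative_iff_has_vector_derivative)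
    then show ?thesis by simp
  qed
  have uv: "u t powr p \<le> v t" if t: "t \<in> {0..1}" for t
  proof (cases "t = 0")
    \<comment> \<open>The convexity inequality needs a positive parameter. At \<open>t = 0\<close> both sides vanish, as \<open>n \<ge> 2\<close>
        and \<open>0 powr q = 0\<close> for every \<open>q\<close>, including \<open>q = 0\<close>.\<close>
    case True
    then show ?thesis using assms by (simp add: u_def v_def)
  next
    case False
    then have t0: "0 < t" "t \<le> 1" using t by auto
    have "\<bar>D n (t * a + m * (1 - t) * b)\<bar> powr p \<le> t powr \<alpha> * A + m * (1 - t powr \<alpha>) * B"
      using assms(12) assms t0 unfolding alpha_m_convex_def D_def A_def B_def by auto
    also have "t * a + m * (1 - t) * b = c - d * t"
      by (simp add: c_def d_def algebra_simps)
    finally have "t powr r * \<bar>D n (c - d * t)\<bar> powr p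
                    \<le> t powr r * (t powr \<alpha> * A + m * (1 - t powr \<alpha>) * B)"
      by (rule mult_left_mono) simp
    moreover have "(t ^ (n - 1)) powr p = t powr r"
      using t0 assms by (simp add: r powr_powr of_nat_diff mult.commute flip: powr_realpow)
    then have "u t powr p = t powr r * \<bar>D n (c - d * t)\<bar> powr p"
      using t0 by (simp add: u_def powr_mult)
    moreover have "t powr r * (t powr \<alpha> * A + m * (1 - t powr \<alpha>) * B) = v t"
      by (simp add: v_def powr_add algebra_simps)
    ultimately show ?thesis by simp
  qed
  have "((\<lambda>t. A * ((real n - 2 * t) * t powr (r + \<alpha>))
            + m * B * ((real n - 2 * t) * t powr r - (real n - 2 * t) * t powr (r + \<alpha>)))
          has_integral A * Q (r + \<alpha>) + m * B * (Q r - Q (r + \<alpha>))) {0..1}"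
    unfolding Q_def using r0 assms
    by (intro has_integral_add has_integral_diff has_integral_mult_right linear_weight_moment) auto
  then have wv: "((\<lambda>t. (real n - 2 * t) * v t) has_integral
                   Q (r + \<alpha>) * A + m * (Q r - Q (r + \<alpha>)) * B) {0..1}"
    by (simp add: v_def algebra_simps)
  have "\<bar>T / C\<bar> \<le> (real n - 1) powr (1 - 1 / p)
                     * (Q (r + \<alpha>) * A + m * (Q r - Q (r + \<alpha>)) * B) powr (1 / p)"
    by (rule weighted_power_mean_integral[OF _ _ w wv h, where u = u])
       (use assms uv in \<open>auto simp: u_def abs_mult mult.assoc\<close>)
  then have "\<bar>T\<bar> \<le> (real n - 1) powr (1 - 1 / p)
                     * (Q (r + \<alpha>) * A + m * (Q r - Q (r + \<alpha>)) * B) powr (1 / p) * C"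
    using C by (simp add: abs_divide pos_divide_le_eq)
  then have "\<bar>T\<bar> \<le> (real n - 1) powr (1 - 1 / p) / 2 * (d ^ n / fact n)
                     * (Q (r + \<alpha>) * A + m * (Q r - Q (r + \<alpha>)) * B) powr (1 / p)"
    by (simp add: C_def mult_ac)
  moreover have "Q r = (real n - 1) * (p * n - 2 * p + 2) / ((p * n - p + 1) * (p * n - p + 2))"
  proof -
    have "(real n - 2) * r + 2 * (real n - 1) = (real n - 1) * (p * n - 2 * p + 2)"
      by (simp add: r algebra_simps)
    then show ?thesis by (simp add: Q_def r_def)
  qed
  moreover have "Q (r + \<alpha>) = ((real n - 2) * (p * n - p + \<alpha>) + 2 * (real n - 1))
                               / ((p * n - p + \<alpha> + 1) * (p * n - p + \<alpha> + 2))"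
    by (simp add: Q_def r_def)
  ultimately show ?thesis
    by (simp only: T_def A_def B_def D_def c_def d_def)
qed

end
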